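(* Let $\Omega$ be an infinite compact metric space, let $T:\Omega\to\Omega$ be a minimal homeomorphism, and let $\mu$ be a $T$-ergodic Borel probability measure on $\Omega$. Suppose $(\Omega,T,\mu)$ satisfies the metric repetition property (MRP). Then there exists a residual subset $\mathcal{F}$ of $C(\Omega)$ such that for every $f\in\mathcal{F}$, there is a subset $\Omega_f\subseteq\Omega$ of full $\mu$ measure with the property that for every $\omega\in\Omega_f$, the potential $V_\omega:\mathbb{Z}\to\mathbb{R}$ defined by $V_\omega(n)=f(T^n\omega)$, $n\in\mathbb{Z}$, is a Gordon potential.
   Context: A homeomorphism $T$ of $\Omega$ is minimal if for every $\omega\in\Omega$ the orbit $\{T^n\omega : n\in\mathbb{Z}\}$ is dense in $\Omega$. A $T$-ergodic measure is a $T$-invariant ergodic measure. $C(\Omega)$ is the space of continuous functions $f:\Omega\to\mathbb{R}$ with the uniform (supremum) norm. A subset of a topological space is residual if it contains a countable intersection of dense open sets. Repetition property: a sequence $\{\omega_k\}_{k\ge 0}$ in $\Omega$ has the repetition property if for every $\varepsilon>0$ and $r>0$ there exists a positive integer $q$ such that $\mathrm{dist}(\omega_k,\omega_{k+q})<\varepsilon$ for $k=0,1,2,\ldots,\lfloor rq\rfloor$. $PRP(\Omega,T)=\{\omega\in\Omega : \{T^k\omega\}_{k\ge 0}\text{ has the repetition property}\}$ (this is always a $G_\delta$ set). $(\Omega,T,\mu)$ satisfies the metric repetition property (MRP) if $\mu(PRP(\Omega,T))>0$. Gordon potential: a bounded function $V:\mathbb{Z}\to\mathbb{R}$ is called a Gordon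 potential if there are positive integers $q_k\to\infty$ such that for every $k\ge 1$, both $\max_{1\le n\le q_k}|V(n)-V(n+q_k)|\le k^{-q_k}$ and $\max_{1\le n\le q_k}|V(n)-V(n-q_k)|\le k^{-q_k}$. *)

theory Defs
  imports "HOL-Probability.Probability"
begin

(* The compact metric space is the whole type 'a, so that C(Omega) is the library type
   'a \<Rightarrow>\<^sub>C real of bounded continuous functions with its supremum metric; boundedness
   is automatic once UNIV is compact. *)

(* Only meaningful for bijective T. *)
definition int_iterate :: "('a \<Rightarrow> 'a) \<Rightarrow> int \<Rightarrow> 'a \<Rightarrow> 'a" where
  "int_iterate T n = (if 0 \<le> n then T ^^ nat n else inv T ^^ nat (- n))"

definition minimal_homeomorphism :: "('a::topological_space \<Rightarrow> 'a) \<Rightarrow> bool" where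
  "minimal_homeomorphism T \<longleftrightarrow>
     homeomorphism UNIV UNIV T (inv T) \<and>
     (\<forall>\<omega>. closure (range (\<lambda>n. int_iterate T n \<omega>)) = UNIV)"

definition ergodic_borel_prob :: "('a::topological_space \<Rightarrow> 'a) \<Rightarrow> 'a measure \<Rightarrow> bool" where
  "ergodic_borel_prob T M \<longleftrightarrow>
     prob_space M \<and> sets M = sets borel \<and>
     T \<in> measurable M M \<and> distr M M T = M \<and>
     (\<forall>A\<in>sets M. T -` A = A \<longrightarrow> measure M A = 0 \<or> measure M A = 1)"

definition repetition_property :: "(nat \<Rightarrow> 'a::metric_space) \<Rightarrow> bool" where
  "repetition_property x \<longleftrightarrow>
     (\<forall>\<epsilon>>0. \<forall>r::real. r > 0 \<longrightarrow>
       (\<exists>q::nat. q > 0 \<and> (\<forall>k::nat. int k \<le> \<lfloor>r * real q\<rfloor> \<longrightarrow> dist (x k) (x (k + q)) < \<epsilon>)))"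

definition PRP :: "('a::metric_space \<Rightarrow> 'a) \<Rightarrow> 'a set" where
  "PRP T = {\<omega>. repetition_property (\<lambda>k. (T ^^ k) \<omega>)}"

(* PRP T is a G_delta set, so its measure is that of a Borel set. *)
definition MRP :: "('a::metric_space \<Rightarrow> 'a) \<Rightarrow> 'a measure \<Rightarrow> bool" where
  "MRP T M \<longleftrightarrow> measure M (PRP T) > 0"

definition residual :: "'a::topological_space set \<Rightarrow> bool" where
  "residual F \<longleftrightarrow>
     (\<exists>\<U>. countable \<U> \<and> (\<forall>U\<in>\<U>. open U \<and> closure U = UNIV) \<and> \<Inter>\<U> \<subseteq> F)"

definition gordon_potential :: "(int \<Rightarrow> real) \<Rightarrow> bool" where
  "gordon_potential V \<longleftrightarrow>
     bounded (range V) \<and>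
     (\<exists>q::nat \<Rightarrow> nat.
        (\<forall>k\<ge>1. q k > 0) \<and> filterlim q at_top sequentially \<and>
        (\<forall>k\<ge>1.
           (MAX n\<in>{1..int (q k)}. \<bar>V n - V (n + int (q k))\<bar>) \<le> real k powi (- int (q k)) \<and>
           (MAX n\<in>{1..int (q k)}. \<bar>V n - V (n - int (q k))\<bar>) \<le> real k powi (- int (q k))))"

end

theory Submission
  imports Defs
begin

text \<open>
  Write \<open>V n = f (U n x)\<close>, where \<open>U n\<close> is the \<open>n\<close>-th iterate of \<open>T\<close>. The potential \<open>V\<close> is Gordon as
  soon as for every \<open>k\<close> some \<open>q > k\<close> satisfies \<open>\<bar>V n - V (n + q)\<bar> < (1 / (k + 1)) ^ q\<close> for
  \<open>\<bar>n\<bar> \<le> q + k\<close>; call \<open>approx_rep f k\<close> the set of points with this property for one \<open>k\<close>. The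
  extra margin \<open>k\<close> in the window gives room for a shift, so the intersection of these decreasing
  sets over all \<open>k\<close> is \<open>T\<close>-invariant, and by ergodicity it has full measure once
  \<open>approx_rep f k\<close> has measure at least a fixed \<open>c > 0\<close> for all \<open>k\<close>
  (\<open>full_measure_of_approx_rep\<close>). It remains to see that the \<open>f\<close> with this lower bound contain a
  dense open set for each \<open>k\<close>; the constant is \<open>c = p / 16\<close>, where \<open>p\<close> is the measure of \<open>PRP T\<close>.

  Given \<open>f\<close>, a nearby continuous \<open>g\<close> is constructed whose repetitions are exact on a set \<open>G\<close> of
  measure at least \<open>p / 16\<close>, with \<open>q\<close> bounded on \<open>G\<close>; every function close enough to \<open>g\<close> then has
  \<open>G\<close> inside its own \<open>approx_rep\<close> set (\<open>dense_interior_large_approx_rep\<close>). To find \<open>g\<close>,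
  note that all points of \<open>PRP T\<close> lie in one of the open sets \<open>almost_return d q\<close>, \<open>q > k\<close>, whose
  points nearly repeat with period \<open>q\<close> along an orbit block of length \<open>10 q\<close>, and that bounded \<open>q\<close>
  account for more than half of \<open>p\<close>. A Vitali covering argument along orbits (\<open>orbit_vitali\<close>)
  selects closed sets of starting points whose blocks are pairwise disjoint and still carry a fixed
  share of \<open>p\<close>. On the union of these blocks, which is closed, \<open>f\<close> can be replaced by its
  periodic continuation from the first \<open>q\<close> points of each block. The change is small, so the Tietze
  extension theorem makes it a small perturbation of \<open>f\<close> on the whole space
  (\<open>periodic_modification\<close>). An inner half of each block consists of points of \<open>G\<close>.
\<close>

section \<open>Two-sided iterates\<close>

lemma int_iterate_0 [simp]: "int_iterate T 0 x = x"
  by (simp add: int_iterate_def)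

lemma int_iterate_of_nat: "int_iterate T (int n) x = (T ^^ n) x"
  by (simp add: int_iterate_def)

lemma int_iterate_plus_1:
  assumes "bij T"
  shows "int_iterate T (n + 1) x = T (int_iterate T n x)"
proof (cases "0 \<le> n")
  case True
  then have "nat (n + 1) = Suc (nat n)" by simp
  with True show ?thesis by (simp add: int_iterate_def)
next
  case False
  then obtain k where k: "n = - int (Suc k)"
    by (metis int_cases not_less of_nat_0_le_iff)
  have n1: "n + 1 = - int k" using k by simp
  have "int_iterate T n x = inv T ((inv T ^^ k) x)"
    using k by (simp add: int_iterate_def nat_add_distrib)
  moreover have "int_iterate T (n + 1) x = (inv T ^^ k) x"
    unfolding n1 by (cases k) (simp_all add: int_iterate_def nat_add_distrib)
  ultimately show ?thesis
    using assms by (simp add: bij_is_surj surj_f_inv_f)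
qed

lemma int_iterate_add:
  assumes "bij T"
  shows "int_iterate T (m + n) x = int_iterate T m (int_iterate T n x)"
proof (induction m rule: int_induct [of _ 0])
  case (step1 i)
  then show ?case
    using int_iterate_plus_1 [OF assms, of "i + n" x]
      int_iterate_plus_1 [OF assms, of i "int_iterate T n x"] by (simp add: ac_simps)
next
  case (step2 i)
  have "T (int_iterate T (i - 1 + n) x) = T (int_iterate T (i - 1) (int_iterate T n x))"
    using step2 int_iterate_plus_1 [OF assms, of "i - 1 + n" x]
      int_iterate_plus_1 [OF assms, of "i - 1" "int_iterate T n x"] by (simp add: ac_simps)
  then show ?case using assms by (simp add: bij_is_inj inj_eq)
qed simp

lemma continuous_on_funpow:
  fixes T :: "'a::topological_space \<Rightarrow> 'a"
  assumes "continuous_on UNIV T"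
  shows "continuous_on UNIV (T ^^ n)"
  by (induction n) (auto simp: id_def intro: continuous_on_compose2 [OF assms] continuous_on_compose assms continuous_on_subset)

lemma continuous_on_int_iterate:
  assumes "homeomorphism UNIV UNIV T (inv T)"
  shows "continuous_on UNIV (int_iterate T n)"
  using assms by (auto simp: int_iterate_def homeomorphism_def intro: continuous_on_funpow)

section \<open>Minimal probability-preserving systems\<close>

locale minimal_pmp = prob_space M for M :: "'a::metric_space measure" +
  fixes T :: "'a \<Rightarrow> 'a"
  assumes infinite_space: "infinite (UNIV :: 'a set)"
    and compact_space: "compact (UNIV :: 'a set)"
    and minimal: "minimal_homeomorphism T"
    and ergodic: "ergodic_borel_prob T M"
begin

abbreviation U :: "int \<Rightarrow> 'a \<Rightarrow> 'a" where "U \<equiv> int_iterate T"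

lemma bij_T: "bij T"
proof -
  have h: "homeomorphism UNIV UNIV T (inv T)"
    using minimal by (simp add: minimal_homeomorphism_def)
  show ?thesis
    by (rule o_bij [of "inv T"]) (use h in \<open>auto simp: homeomorphism_def fun_eq_iff\<close>)
qed

lemma U_add: "U (m + n) x = U m (U n x)"
  by (rule int_iterate_add [OF bij_T])

lemma U_minus_cancel [simp]: "U n (U (- n) x) = x" "U (- n) (U n x) = x"
  by (simp_all flip: U_add)

lemma U_1: "U 1 x = T x"
  using int_iterate_plus_1 [OF bij_T, of 0 x] by simp

lemma U_image_eq_vimage: "U n ` A = U (- n) -` A"
proof (intro equalityI subsetI)
  fix x assume "x \<in> U (- n) -` A"
  then have "U n (U (- n) x) \<in> U n ` A" by blast
  then show "x \<in> U n ` A" by simp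
qed auto

lemma continuous_U: "continuous_on UNIV (U n)"
  using minimal by (intro continuous_on_int_iterate) (simp add: minimal_homeomorphism_def)

lemma continuous_U' [continuous_intros]:
  "continuous_on S g \<Longrightarrow> continuous_on S (\<lambda>x. U n (g x))"
  by (rule continuous_on_compose2 [OF continuous_U]) auto

lemma sets_M: "sets M = sets borel"
  using ergodic by (simp add: ergodic_borel_prob_def)

lemma space_M: "space M = UNIV"
  using sets_eq_imp_space_eq [OF sets_M] by simp

lemma open_in_sets: "open A \<Longrightarrow> A \<in> sets M"
  by (simp add: sets_M)

lemma closed_in_sets: "closed A \<Longrightarrow> A \<in> sets M"
  by (simp add: sets_M borel_closed)

lemma U_measurable [measurable]: "U n \<in> M \<rightarrow>\<^sub>M M"
  using borel_measurable_continuous_onI [OF continuous_U]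
  by (simp add: sets_M cong: measurable_cong_sets)

lemma U_vimage_in_sets: "A \<in> sets M \<Longrightarrow> U n -` A \<in> sets M"
  using measurable_sets [OF U_measurable, of A n] by (simp add: space_M)

lemma measure_T_vimage: "A \<in> sets M \<Longrightarrow> measure M (T -` A) = measure M A"
  using ergodic measure_distr [of T M M A]
  by (simp add: ergodic_borel_prob_def space_M)

lemma measure_U_vimage:
  assumes "A \<in> sets M"
  shows "measure M (U n -` A) = measure M A"
proof -
  have pos: "measure M (U (int k) -` B) = measure M B" if "B \<in> sets M" for k B
    using that
  proof (induction k arbitrary: B)
    case (Suc k)
    have "U (int (Suc k)) -` B = U (int k) -` (T -` B)"
      using int_iterate_plus_1 [OF bij_T, of "int k"] by (auto simp: add.commute)
    moreover have "T -` B \<in> sets M"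
      using measurable_sets [of T M M B] ergodic Suc.prems
      by (simp add: ergodic_borel_prob_def space_M)
    ultimately show ?case using Suc measure_T_vimage by simp
  qed (simp add: vimage_def)
  show ?thesis
  proof (cases n rule: int_cases2)
    case (nonneg k)
    then show ?thesis using pos assms by simp
  next
    case (nonpos k)
    have "measure M (U (int k) -` (U n -` A)) = measure M (U n -` A)"
      by (rule pos) (rule U_vimage_in_sets [OF assms])
    moreover have "U (int k) -` (U n -` A) = A"
      using nonpos by (auto simp flip: vimage_comp)
    ultimately show ?thesis by simp
  qed
qed

text \<open>A periodic orbit is finite, hence closed, so by minimality it would be the whole infinite space.\<close>

lemma aperiodic:
  assumes "n \<noteq> 0"
  shows "U n x \<noteq> x"
proof
  assume fixed: "U n x = x"
  define N where "N = \<bar>n\<bar>"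
  have N: "N > 0" using assms by (simp add: N_def)
  have "U (- n) x = x" using arg_cong [OF fixed, of "U (- n)"] by simp
  then have 1: "U N x = x" using fixed by (auto simp: N_def abs_if)
  have "U (- N) x = x" using arg_cong [OF 1, of "U (- N)"] by simp
  have mult: "U (N * k) x = x" for k
  proof (induction k rule: int_induct [of _ 0])
    case (step1 i) then show ?case using U_add [of N "N * i" x] 1 by (simp add: algebra_simps)
  next
    case (step2 i) then show ?case using U_add [of "-N" "N * i" x] \<open>U (- N) x = x\<close>
      by (simp add: algebra_simps)
  qed simp
  have "U k x = U (k mod N) x" for k
    using U_add [of "k mod N" "N * (k div N)" x] mult [of "k div N"] by (simp only: mod_mult_div_eq)
  moreover have "k mod N \<in> {0..<N}" for k using N by simp
  ultimately have "range (\<lambda>k. U k x) \<subseteq> (\<lambda>j. U j x) ` {0..<N}" by blast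
  then have "finite (range (\<lambda>k. U k x))" by (rule finite_subset) simp
  then have "closure (range (\<lambda>k. U k x)) = range (\<lambda>k. U k x)"
    by (simp add: finite_imp_closed)
  then have "range (\<lambda>k. U k x) = UNIV"
    using minimal by (simp add: minimal_homeomorphism_def)
  with \<open>finite _\<close> infinite_space show False by simp
qed

text \<open>
  By compactness, aperiodicity is quantitative. This yields both small open sets that stay disjoint
  from their first iterates and a lower bound for the period of a close repetition.
\<close>

lemma displacement_bounded_below:
  obtains d where "d > 0" "\<And>x j. 0 < j \<Longrightarrow> j < N \<Longrightarrow> d \<le> dist x (U j x)"
proof -
  have one: "\<exists>d>0. \<forall>x. d \<le> dist x (U j x)" if j: "j \<in> {0<..<N}" for j
  proof -
    have "continuous_on UNIV (\<lambda>x. dist x (U j x))" by (intro continuous_intros)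
    then obtain z where "\<And>x. dist z (U j z) \<le> dist x (U j x)"
      using continuous_attains_inf [OF compact_space, of "\<lambda>x. dist x (U j x)"] by auto
    moreover have "dist z (U j z) > 0" using aperiodic [of j z] j by auto
    ultimately show ?thesis by blast
  qed
  then obtain d where d: "\<And>j. j \<in> {0<..<N} \<Longrightarrow> d j > 0 \<and> (\<forall>x. d j \<le> dist x (U j x))"
    by metis
  define e where "e = Min (insert 1 (d ` {0<..<N}))"
  show thesis
  proof
    show "e > 0" unfolding e_def using d by (subst Min_gr_iff) auto
    show "e \<le> dist x (U j x)" if "0 < j" "j < N" for x j
    proof -
      have "e \<le> d j" unfolding e_def using that by (intro Min_le) auto
      also have "d j \<le> dist x (U j x)" using d [of j] that by simp
      finally show ?thesis .
    qed
  qed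
qed

lemma finite_wandering_cover:
  obtains \<W> :: "'a set set" where "finite \<W>" "\<Union>\<W> = UNIV" "\<And>W. W \<in> \<W> \<Longrightarrow> open W"
    "\<And>W x j. W \<in> \<W> \<Longrightarrow> x \<in> W \<Longrightarrow> 0 < j \<Longrightarrow> j < N \<Longrightarrow> U j x \<notin> W"
proof -
  obtain d where d: "d > 0" "\<And>x j. 0 < j \<Longrightarrow> j < N \<Longrightarrow> d \<le> dist x (U j x)"
    using displacement_bounded_below [of N] by metis
  have "(UNIV :: 'a set) \<subseteq> (\<Union>a. ball a (d / 2))" using d(1) by auto
  then obtain A where A: "finite A" "(UNIV :: 'a set) \<subseteq> (\<Union>a\<in>A. ball a (d / 2))"
    by (rule compactE_image [OF compact_space open_ball])
  show thesis
  proof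
    show "finite ((\<lambda>a. ball a (d / 2)) ` A)" using A by simp
    show "\<Union>((\<lambda>a. ball a (d / 2)) ` A) = UNIV" using A by blast
    show "open W" if "W \<in> (\<lambda>a. ball a (d / 2)) ` A" for W using that by auto
    fix W x j assume *: "W \<in> (\<lambda>a. ball a (d / 2)) ` A" "x \<in> W" "0 < j" "j < N"
    then obtain a where a: "W = ball a (d / 2)" by auto
    show "U j x \<notin> W"
    proof
      assume "U j x \<in> W"
      then have "dist x (U j x) < d"
        using * a dist_triangle_half_l [of x a d "U j x"] by (simp add: dist_commute)
      then show False using d(2) [of j x] * by simp
    qed
  qed
qed

text \<open>
  An open set is exhausted by the closed sets of points at distance at least \<open>1 / n\<close> from its
  complement.
\<close>

lemma closed_inner_approx:
  assumes "open D" "e > 0"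
  obtains C where "closed C" "C \<subseteq> D" "measure M (D - C) < e"
proof (cases "D = UNIV")
  case True
  then show thesis using that [of UNIV] assms by simp
next
  case False
  define B where "B n = D \<inter> {x. infdist x (- D) < 1 / real (Suc n)}" for n
  have opn: "open {x. infdist x (- D) < r}" for r
    by (intro open_Collect_less continuous_intros)
  have "range B \<subseteq> sets M" using opn assms by (auto simp: B_def intro!: open_in_sets)
  moreover have "B (Suc n) \<subseteq> B n" for n
  proof -
    have "1 / real (Suc (Suc n)) \<le> 1 / real (Suc n)" by (simp add: field_simps)
    then show ?thesis unfolding B_def by (auto simp del: of_nat_Suc)
  qed
  then have "decseq B" by (simp add: decseq_Suc_iff)
  ultimately have lim: "(\<lambda>n. measure M (B n)) \<longlonglongrightarrow> measure M (\<Inter>n. B n)"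
    by (rule finite_Lim_measure_decseq)
  have "(\<Inter>n. B n) = {}"
  proof -
    have "False" if x: "x \<in> (\<Inter>n. B n)" for x
    proof -
      have "x \<in> D" using x by (auto simp: B_def)
      then have "infdist x (- D) > 0"
        using infdist_pos_not_in_closed [of "- D" x] assms False by auto
      then obtain n where "1 / real (Suc n) < infdist x (- D)"
        using nat_approx_posE by blast
      then show False using x by (auto simp: B_def dest!: spec [of _ n])
    qed
    then show ?thesis by blast
  qed
  then have "\<forall>\<^sub>F n in sequentially. measure M (B n) < e"
    using lim assms order_tendstoD(2) [OF lim, of e] by simp
  then obtain n where n: "measure M (B n) < e" by (auto simp: eventually_sequentially)
  show thesis
  proof
    have "closed {x. 1 / real (Suc n) \<le> infdist x (- D)}"
      by (intro closed_Collect_le continuous_intros)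
    then show "closed {x. 1 / real (Suc n) \<le> infdist x (- D)}" .
    show "{x. 1 / real (Suc n) \<le> infdist x (- D)} \<subseteq> D"
    proof
      fix x assume *: "x \<in> {x. 1 / real (Suc n) \<le> infdist x (- D)}"
      show "x \<in> D"
      proof (rule ccontr)
        assume "x \<notin> D"
        then have "infdist x (- D) = 0" by simp
        moreover have "0 < 1 / real (Suc n)" by simp
        ultimately show False using * by auto
      qed
    qed
    have "D - {x. 1 / real (Suc n) \<le> infdist x (- D)} = B n" by (auto simp: B_def)
    with n show "measure M (D - {x. 1 / real (Suc n) \<le> infdist x (- D)}) < e" by simp
  qed
qed

section \<open>Disjoint orbit blocks\<close>

lemma closed_U_image: "closed C \<Longrightarrow> closed (U n ` C)"
  unfolding U_image_eq_vimage by (rule closed_vimage [OF _ continuous_U])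

text \<open>
  The block of a point \<open>x \<in> C i\<close> is its orbit segment at the times \<open>0 \<le> a < h i\<close>. Because every \<open>U a\<close> is
  injective, the condition says that distinct blocks never meet; equivalently, the sets \<open>U a ` C i\<close>
  with \<open>i \<in> I\<close> and \<open>0 \<le> a < h i\<close> are pairwise disjoint.
\<close>

definition disjoint_blocks :: "'i set \<Rightarrow> ('i \<Rightarrow> int) \<Rightarrow> ('i \<Rightarrow> 'a set) \<Rightarrow> bool" where
  "disjoint_blocks I h C \<longleftrightarrow> (\<forall>i\<in>I. \<forall>j\<in>I. \<forall>a\<in>{0..<h i}. \<forall>b\<in>{0..<h j}. \<forall>x\<in>C i. \<forall>y\<in>C j.
     U a x = U b y \<longrightarrow> i = j \<and> a = b)"

lemma disjoint_blocksD:
  "disjoint_blocks I h C \<Longrightarrow> i \<in> I \<Longrightarrow> j \<in> I \<Longrightarrow> a \<in> {0..<h i} \<Longrightarrow> b \<in> {0..<h j} \<Longrightarrow>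
    x \<in> C i \<Longrightarrow> y \<in> C j \<Longrightarrow> U a x = U b y \<Longrightarrow> i = j \<and> a = b"
  unfolding disjoint_blocks_def by blast

text \<open>
  The Vitali covering argument along orbits. Indices are treated in the order of decreasing block
  length: from \<open>E i\<close> remove the starting points whose block would meet a block chosen before, and
  keep the rest. A removed point lies on the orbit of a chosen starting point, at a time of
  absolute value below the length of the chosen block, because that block is at least as long as the one rejected. So the
  chosen blocks, doubled to the left, cover all
  \<open>E i\<close>. Each chosen set is thinned to a
  closed subset; the union of the chosen blocks is then closed and the next set to choose from is
  again open. The losses of the thinning, at most \<open>e\<close> per index, are
  collected in \<open>N\<close> and excepted from the covering.
\<close>

lemma orbit_vitali:
  fixes E :: "'i \<Rightarrow> 'a set" and h :: "'i \<Rightarrow> int"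
  assumes "finite I"
    and "\<And>i. i \<in> I \<Longrightarrow> open (E i)"
    and "\<And>i. i \<in> I \<Longrightarrow> h i > 0"
    and "\<And>i x j. i \<in> I \<Longrightarrow> x \<in> E i \<Longrightarrow> 0 < j \<Longrightarrow> j < h i \<Longrightarrow> U j x \<notin> E i"
    and "e > 0"
  shows "\<exists>C N. (\<forall>i\<in>I. closed (C i) \<and> C i \<subseteq> E i) \<and>
    disjoint_blocks I h C \<and>
    N \<in> sets M \<and> measure M N \<le> real (card I) * e \<and>
    (\<forall>i\<in>I. E i \<subseteq> N \<union> (\<Union>j\<in>I. \<Union>m\<in>{- h j<..<h j}. U m -` C j))"
  using assms(1-4)
proof (induction I rule: finite_ranking_induct [where f = "\<lambda>i. - h i"])
  case empty
  show ?case by (intro exI [of _ "\<lambda>_. {}"] exI [of _ "{}"]) (simp add: disjoint_blocks_def)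
next
  case (insert i0 I)
  show ?case
  proof (cases "i0 \<in> I")
    case True
    then have "insert i0 I = I" by blast
    then show ?thesis using insert.IH insert.prems by simp
  next
    case False
    obtain C N where C': "\<forall>i\<in>I. closed (C i) \<and> C i \<subseteq> E i" and disj: "disjoint_blocks I h C"
      and N: "N \<in> sets M" "measure M N \<le> real (card I) * e"
      and cover: "\<forall>i\<in>I. E i \<subseteq> N \<union> (\<Union>j\<in>I. \<Union>m\<in>{- h j<..<h j}. U m -` C j)"
    proof -
      have "\<exists>C N. (\<forall>i\<in>I. closed (C i) \<and> C i \<subseteq> E i) \<and> disjoint_blocks I h C \<and>
        N \<in> sets M \<and> measure M N \<le> real (card I) * e \<and>
        (\<forall>i\<in>I. E i \<subseteq> N \<union> (\<Union>j\<in>I. \<Union>m\<in>{- h j<..<h j}. U m -` C j))"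
        using insert.prems by (intro insert.IH) blast+
      then show thesis using that by (elim exE conjE)
    qed
    then have C: "closed (C i)" "C i \<subseteq> E i" if "i \<in> I" for i
      using that by blast+
    \<comment> \<open>\<open>P\<close> is the union of the earlier blocks, \<open>D\<close> the set of starts in \<open>E i0\<close> that do not conflict with it.\<close>
    define P where "P = (\<Union>j\<in>I. \<Union>b\<in>{0..<h j}. U b ` C j)"
    have "closed P" unfolding P_def using insert.hyps(1) C(1)
      by (auto intro!: closed_UN closed_U_image)
    define D where "D = E i0 - (\<Union>a\<in>{0..<h i0}. U a -` P)"
    have "closed (\<Union>a\<in>{0..<h i0}. U a -` P)"
      by (intro closed_UN finite_atLeastLessThan_int ballI closed_vimage [OF \<open>closed P\<close> continuous_U])
    then have "open D" unfolding D_def using insert.prems(1) by (intro open_Diff) auto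
    then obtain C0 where C0: "closed C0" "C0 \<subseteq> D" "measure M (D - C0) < e"
      using closed_inner_approx \<open>e > 0\<close> by metis
    define C' where "C' = C(i0 := C0)"
    have C'_simps: "C' i0 = C0" "\<And>i. i \<in> I \<Longrightarrow> C' i = C i"
      using False by (auto simp: C'_def)
    have meets: False if "a \<in> {0..<h i0}" "j \<in> I" "b \<in> {0..<h j}" "x \<in> C0" "y \<in> C j"
      "U a x = U b y" for a b j x y
    proof -
      have "U a x \<in> P" unfolding P_def using that by blast
      then have "x \<notin> D" unfolding D_def using that by blast
      then show False using that C0 by blast
    qed
    have own: "a = b" if "a \<in> {0..<h i0}" "b \<in> {0..<h i0}" "x \<in> C0" "y \<in> C0" "U a x = U b y"
      for a b x y
    proof -
      have xy: "x \<in> E i0" "y \<in> E i0" using that C0 by (auto simp: D_def)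
      have "U (b - a) y = x" using that(5) U_add [of "- a" b y] by (simp flip: that(5))
      moreover have "U (a - b) x = y" using that(5) U_add [of "- b" a x] by simp
      ultimately show ?thesis
        using insert.prems(3) [of i0 y "b - a"] insert.prems(3) [of i0 x "a - b"] xy that
        by (cases a b rule: linorder_cases) auto
    qed
    have "i = j \<and> a = b" if ass: "i \<in> insert i0 I" "j \<in> insert i0 I" "a \<in> {0..<h i}" "b \<in> {0..<h j}"
      "x \<in> C' i" "y \<in> C' j" "U a x = U b y" for i j a b x y
    proof -
      consider "i = i0" "j = i0" | "i = i0" "j \<in> I" | "i \<in> I" "j = i0" | "i \<in> I" "j \<in> I"
        using ass(1,2) by blast
      then show ?thesis
      proof cases
        case 1 then show ?thesis using own ass by (simp add: C'_simps)
      next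
        case 2 then show ?thesis using meets [of a j b x y] ass by (simp add: C'_simps)
      next
        case 3 then show ?thesis using meets [of b i a y x] ass by (simp add: C'_simps)
      next
        case 4 then show ?thesis using disjoint_blocksD [OF disj, of i j a b x y] ass by (simp add: C'_simps)
      qed
    qed
    then have "disjoint_blocks (insert i0 I) h C'" unfolding disjoint_blocks_def by blast
    moreover have "closed (C' i) \<and> C' i \<subseteq> E i" if "i \<in> insert i0 I" for i
    proof (cases "i \<in> I")
      case True
      then show ?thesis using C C'_simps(2) by simp
    next
      case False
      then have "i = i0" using that by simp
      then show ?thesis using C0(1,2) C'_simps(1) by (auto simp: D_def)
    qed
    then have "\<forall>i\<in>insert i0 I. closed (C' i) \<and> C' i \<subseteq> E i" by blast
    moreover have meas: "D - C0 \<in> sets M"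
      using open_in_sets [OF \<open>open D\<close>] closed_in_sets [OF C0(1)] by blast
    then have "N \<union> (D - C0) \<in> sets M" using N by blast
    moreover have "measure M (N \<union> (D - C0)) \<le> real (card (insert i0 I)) * e"
      using measure_Un_le [OF N(1) meas] N(2) C0(3) False insert.hyps(1)
      by (simp add: algebra_simps)
    moreover have "z \<in> (N \<union> (D - C0)) \<union> (\<Union>j\<in>insert i0 I. \<Union>m\<in>{- h j<..<h j}. U m -` C' j)"
      if "i \<in> insert i0 I" "z \<in> E i" for i z
    proof (cases "i \<in> I")
      case True
      have "z \<in> N \<union> (\<Union>j\<in>I. \<Union>m\<in>{- h j<..<h j}. U m -` C j)" using cover True that(2) by blast
      moreover have "(\<Union>j\<in>I. \<Union>m\<in>{- h j<..<h j}. U m -` C j)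
          = (\<Union>j\<in>I. \<Union>m\<in>{- h j<..<h j}. U m -` C' j)"
        using C'_simps(2) by simp
      ultimately show ?thesis by blast
    next
      case i: False
      then have z: "z \<in> E i0" using that by simp
      show ?thesis
      proof (cases "z \<in> D")
        case True
        have "0 \<in> {- h i0<..<h i0}" using insert.prems(2) by simp
        moreover have "U 0 z \<in> C' i0" if "z \<in> C0" using that C'_simps(1) by simp
        ultimately show ?thesis using True by blast
      next
        case False
        then obtain a j b y where *: "a \<in> {0..<h i0}" "j \<in> I" "b \<in> {0..<h j}" "y \<in> C j"
          "U a z = U b y"
          using z unfolding D_def P_def by blast
        have "U (a - b) z = y" using *(5) U_add [of "- b" a z] by simp
        then have "U (a - b) z \<in> C' j" using *(2,4) C'_simps(2) by simp
        moreover have "a - b \<in> {- h j<..<h j}" using *(1-3) insert.hyps(2) [of j] by simp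
        ultimately show ?thesis using *(2) by blast
      qed
    qed
    then have "\<forall>i\<in>insert i0 I. E i \<subseteq> (N \<union> (D - C0)) \<union>
        (\<Union>j\<in>insert i0 I. \<Union>m\<in>{- h j<..<h j}. U m -` C' j)"
      by (intro ballI subsetI)
    ultimately show ?thesis by (intro exI [of _ C'] exI [of _ "N \<union> (D - C0)"] conjI)
  qed
qed

text \<open>
  On the closed union of the blocks the wanted values are \<open>f\<close> composed with a shift that is constant
  on each of the finitely many disjoint closed sets \<open>U a ` C i\<close>, so they depend continuously on the
  point there. Extending the difference from \<open>f\<close>, rather than the new function itself, keeps the
  extension within \<open>e\<close> of \<open>f\<close> everywhere.
\<close>

lemma periodic_modification:
  fixes f :: "'a \<Rightarrow>\<^sub>C real" and C :: "'i \<Rightarrow> 'a set" and h q :: "'i \<Rightarrow> int"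
  assumes "finite I" and "\<And>i. i \<in> I \<Longrightarrow> closed (C i)"
    and disj: "disjoint_blocks I h C"
    and close: "\<And>i a x. i \<in> I \<Longrightarrow> a \<in> {0..<h i} \<Longrightarrow> x \<in> C i \<Longrightarrow>
        \<bar>apply_bcontfun f (U (a mod q i) x) - apply_bcontfun f (U a x)\<bar> \<le> e"
    and "e \<ge> 0"
  obtains g :: "'a \<Rightarrow>\<^sub>C real" where "dist g f \<le> e"
    "\<And>i a x. i \<in> I \<Longrightarrow> a \<in> {0..<h i} \<Longrightarrow> x \<in> C i \<Longrightarrow>
        apply_bcontfun g (U a x) = apply_bcontfun f (U (a mod q i) x)"
proof -
  let ?f = "apply_bcontfun f"
  define J where "J = (SIGMA i:I. {0..<h i})"
  define B where "B = (\<lambda>(i, a). U a ` C i)"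
  define idx where "idx z = (THE p. p \<in> J \<and> z \<in> B p)" for z
  have idx: "idx z = p" if p: "p \<in> J" "z \<in> B p" for p z
    unfolding idx_def
  proof (rule the_equality)
    fix p' assume p': "p' \<in> J \<and> z \<in> B p'"
    then obtain i a i' a' x x' where "p = (i, a)" "p' = (i', a')" "x \<in> C i" "x' \<in> C i'"
      "z = U a x" "z = U a' x'"
      using p by (auto simp: B_def J_def)
    then show "p' = p" using disjoint_blocksD [OF disj, of i' i a' a x' x] p p' by (auto simp: J_def)
  qed (use p in simp)
  define c where "c p z = ?f (U (snd p mod q (fst p) - snd p) z) - ?f z" for p z
  define u where "u z = c (idx z) z" for z
  have "finite J" unfolding J_def using \<open>finite I\<close> by auto
  have closed_B: "closed (B p)" if "p \<in> J" for p
    using that assms(2) by (auto simp: B_def J_def intro: closed_U_image)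
  have cont_c: "continuous_on (B p) (c p)" for p
    unfolding c_def
    by (intro continuous_intros continuous_on_compose2 [OF continuous_on_apply_bcontfun [of UNIV]]) auto
  have "continuous_on (B p) u" if "p \<in> J" for p
    by (rule continuous_on_eq [OF cont_c]) (simp add: u_def idx [OF that])
  then have cont_u: "continuous_on (\<Union>p\<in>J. B p) u"
    by (intro continuous_on_closed_Union \<open>finite J\<close> closed_B)
  have u_eq: "u (U a x) = ?f (U (a mod q i) x) - ?f (U a x)"
    if "i \<in> I" "a \<in> {0..<h i}" "x \<in> C i" for i a x
  proof -
    have "idx (U a x) = (i, a)" using that by (intro idx) (auto simp: J_def B_def)
    then show ?thesis using U_add [of "a mod q i - a" a x] by (simp add: u_def c_def)
  qed
  have bound_u: "u ` (\<Union>p\<in>J. B p) \<subseteq> {- e..e}"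
  proof clarify
    fix i a z assume "(i, a) \<in> J" "z \<in> B (i, a)"
    then obtain x where x: "i \<in> I" "a \<in> {0..<h i}" "x \<in> C i" "z = U a x"
      by (auto simp: J_def B_def)
    then show "u z \<in> {- e..e}" using close [OF x(1-3)] u_eq [OF x(1-3)] by (simp add: abs_le_iff)
  qed
  have "closed (\<Union>p\<in>J. B p)" using \<open>finite J\<close> closed_B by auto
  moreover have "normal_space (euclidean :: 'a topology)"
    by (intro metrizable_imp_normal_space metrizable_space_euclidean)
  ultimately obtain v where v: "continuous_map euclidean euclideanreal v"
    "\<And>z. z \<in> (\<Union>p\<in>J. B p) \<Longrightarrow> v z = u z" "v ` topspace euclidean \<subseteq> {- e..e}"
    using Tietze_extension_closed_real_interval [of euclidean "\<Union>p\<in>J. B p" u "- e" e]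
      cont_u bound_u \<open>e \<ge> 0\<close> by (auto simp: closed_closedin [symmetric])
  have v_bound: "\<bar>v z\<bar> \<le> e" for z using v(3) by (auto simp: image_subset_iff abs_le_iff minus_le_iff)
  have "v \<in> bcontfun"
    using v(1) v_bound by (intro bcontfun_normI) auto
  then have ap: "apply_bcontfun (f + Bcontfun v) z = ?f z + v z" for z
    by (simp add: Bcontfun_inverse)
  show thesis
  proof
    show "dist (f + Bcontfun v) f \<le> e"
      by (rule dist_bound) (use ap v_bound in \<open>simp add: dist_real_def\<close>)
    show "apply_bcontfun (f + Bcontfun v) (U a x) = ?f (U (a mod q i) x)"
      if "i \<in> I" "a \<in> {0..<h i}" "x \<in> C i" for i a x
    proof -
      have "U a x \<in> (\<Union>p\<in>J. B p)" using that by (force simp: J_def B_def)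
      then show ?thesis using ap v(2) u_eq [OF that] by simp
    qed
  qed
qed

section \<open>Density of functions with exact repetitions\<close>

text \<open>
  Block length \<open>10 q\<close>: exact repetition on the window \<open>[- q - k, q + k]\<close> with step \<open>q > k\<close> looks at
  times between \<open>- 2 q\<close> and \<open>3 q\<close>, so the points at the times \<open>2 q, \<dots>, 7 q - 1\<close> of a block, half
  of the block, see only their own block.
\<close>

definition almost_return :: "real \<Rightarrow> nat \<Rightarrow> 'a set" where
  "almost_return e q = {x. \<forall>j\<in>{0..10 * int q}. dist (U j x) (U (j + int q) x) < e}"

lemma open_almost_return: "open (almost_return e q)"
proof -
  have "almost_return e q = (\<Inter>j\<in>{0..10 * int q}. {x. dist (U j x) (U (j + int q) x) < e})"
    by (auto simp: almost_return_def)
  then show ?thesis by (auto intro!: open_INT open_Collect_less continuous_intros)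
qed

text \<open>Going back from time \<open>a\<close> to \<open>a mod q\<close> takes fewer than ten steps of length \<open>q\<close>, each of which changes \<open>f\<close> by less than \<open>e / 10\<close>.\<close>

lemma almost_return_oscillation:
  assumes "x \<in> almost_return d q" "q > 0" "a \<in> {0..<10 * int q}"
    and f: "\<And>x y. dist x y < d \<Longrightarrow> \<bar>f x - f y\<bar> < e / 10"
  shows "\<bar>f (U (a mod int q) x) - f (U a x)\<bar> \<le> (e :: real)"
proof -
  define r where "r = a mod int q"
  have r: "0 \<le> r" "r < int q" using assms(2) by (auto simp: r_def)
  have "dist (U 0 x) (U (0 + int q) x) < d"
    using assms(1,2) by (auto simp: almost_return_def dest!: bspec [of _ _ 0])
  then have "d > 0" by (rule order_le_less_trans [OF zero_le_dist])
  then have "e > 0" using f [of x x] by simp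
  have step: "\<bar>f (U r x) - f (U (r + int l * int q) x)\<bar> \<le> real l * (e / 10)" if "l \<le> 10" for l
    using that
  proof (induction l)
    case (Suc l)
    have "int l * int q \<le> 9 * int q" using Suc.prems by (intro mult_right_mono) auto
    moreover have "0 \<le> int l * int q" by simp
    ultimately have "r + int l * int q \<in> {0..10 * int q}"
      unfolding atLeastAtMost_iff using r by linarith
    then have "dist (U (r + int l * int q) x) (U (r + int l * int q + int q) x) < d"
      using assms(1) by (auto simp: almost_return_def)
    note near = f [OF this]
    have next_eq: "r + int (Suc l) * int q = r + int l * int q + int q"
      "real (Suc l) * (e / 10) = real l * (e / 10) + e / 10"
      by (simp_all add: distrib_right)
    have "\<bar>f (U r x) - f (U (r + int l * int q) x)\<bar> \<le> real l * (e / 10)"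
      using Suc by simp
    then show ?case unfolding next_eq using near by linarith
  qed simp
  define l where "l = nat (a div int q)"
  have nn: "a div int q \<ge> 0" using assms by (simp add: pos_imp_zdiv_nonneg_iff)
  moreover have "a div int q < 10"
  proof (rule ccontr)
    assume "\<not> a div int q < 10"
    then have "10 * int q \<le> a div int q * int q" by (intro mult_right_mono) auto
    also have "\<dots> \<le> a" using assms(2) div_mult_mod_eq [of a "int q"] pos_mod_sign [of "int q" a]
      by linarith
    finally show False using assms(3) by simp
  qed
  ultimately have l: "l \<le> 10" "int l = a div int q" by (auto simp: l_def)
  have "r + int l * int q = a" unfolding l(2) r_def by (metis add.commute div_mult_mod_eq)
  then have "\<bar>f (U r x) - f (U a x)\<bar> \<le> real l * (e / 10)" using step [OF l(1)] by simp
  also have "\<dots> \<le> 10 * (e / 10)" using l(1) \<open>e > 0\<close> by (intro mult_right_mono) auto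
  finally show ?thesis by (simp add: r_def)
qed

text \<open>
  The repetition property yields some period \<open>q\<close>. It exceeds \<open>k\<close> when the required closeness is
  below the smallest displacement under the first \<open>k\<close> iterates.
\<close>

lemma PRP_subset_almost_return:
  assumes "e > 0"
  shows "PRP T \<subseteq> (\<Union>q\<in>{k<..}. almost_return e q)"
proof
  fix x assume x: "x \<in> PRP T"
  obtain d where d: "d > 0" "\<And>x j. 0 < j \<Longrightarrow> j < int k + 1 \<Longrightarrow> d \<le> dist x (U j x)"
    using displacement_bounded_below [of "int k + 1"] by metis
  have "min d e > 0" using d assms by simp
  moreover have "\<forall>\<epsilon>>0. \<forall>r::real. r > 0 \<longrightarrow> (\<exists>q::nat. q > 0 \<and>
      (\<forall>j::nat. int j \<le> \<lfloor>r * real q\<rfloor> \<longrightarrow> dist ((T ^^ j) x) ((T ^^ (j + q)) x) < \<epsilon>))"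
    using x by (simp only: PRP_def repetition_property_def mem_Collect_eq)
  moreover have "(10 :: real) > 0" by simp
  ultimately obtain q where q: "q > 0"
    "\<And>j. int j \<le> \<lfloor>10 * real q\<rfloor> \<Longrightarrow> dist ((T ^^ j) x) ((T ^^ (j + q)) x) < min d e"
    by metis
  have rep: "dist (U j x) (U (j + int q) x) < min d e" if "j \<in> {0..10 * int q}" for j
  proof -
    have "\<lfloor>10 * real q\<rfloor> = 10 * int q" by linarith
    then have "dist ((T ^^ nat j) x) ((T ^^ (nat j + q)) x) < min d e"
      using that by (intro q) simp
    then show ?thesis using that by (simp flip: int_iterate_of_nat)
  qed
  have "k < q"
  proof (rule ccontr)
    assume "\<not> k < q"
    then have "d \<le> dist x (U (int q) x)" using q by (intro d) auto
    then show False using rep [of 0] by simp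
  qed
  moreover have "x \<in> almost_return e q" using rep by (simp add: almost_return_def)
  ultimately show "x \<in> (\<Union>q\<in>{k<..}. almost_return e q)" by blast
qed

lemma bounded_almost_return:
  assumes "e > 0" "measure M (PRP T) > c"
  obtains Q where "measure M (\<Union>q\<in>{k<..Q}. almost_return e q) > c"
proof -
  define A where "A n = (\<Union>q\<in>{k<..n}. almost_return e q)" for n
  have sets: "range A \<subseteq> sets M"
    by (auto simp: A_def intro!: open_in_sets open_almost_return)
  have "incseq A" by (force simp: A_def incseq_def)
  with sets have lim: "(\<lambda>n. measure M (A n)) \<longlonglongrightarrow> measure M (\<Union>n. A n)"
    by (rule finite_Lim_measure_incseq)
  have "PRP T \<subseteq> (\<Union>n. A n)"
    using PRP_subset_almost_return [OF assms(1), of k] by (fastforce simp: A_def)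
  then have "measure M (PRP T) \<le> measure M (\<Union>n. A n)"
    using sets by (intro finite_measure_mono) auto
  then have "\<forall>\<^sub>F n in sequentially. c < measure M (A n)"
    using assms by (intro order_tendstoD(1) [OF lim]) auto
  then show thesis using that by (auto simp: eventually_sequentially A_def)
qed

text \<open>
  The covering argument applies after cutting each \<open>almost_return e q\<close> into pieces whose points do
  not meet their piece again within one block length; \<open>I\<close> indexes pairs of a period and a piece.
  The sum is an upper bound for the measure of the doubled blocks. It is at least \<open>p / 4\<close>, the
  almost returning points having measure above \<open>p / 2\<close> and the exceptional set at most \<open>p / 4\<close>.
\<close>

lemma disjoint_repetitive_blocks:
  assumes "e > 0" "measure M (PRP T) > 0"
  obtains I :: "(nat \<times> 'a set) set" and C Q where
    "finite I" "fst ` I \<subseteq> {k<..Q}" "\<And>i. i \<in> I \<Longrightarrow> closed (C i)"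
    "\<And>i. i \<in> I \<Longrightarrow> C i \<subseteq> almost_return e (fst i)"
    "disjoint_blocks I (\<lambda>i. 10 * int (fst i)) C"
    "measure M (PRP T) / 4 \<le> (\<Sum>i\<in>I. 20 * real (fst i) * measure M (C i))"
proof -
  define p where "p = measure M (PRP T)"
  obtain Q where Q: "measure M (\<Union>q\<in>{k<..Q}. almost_return e q) > p / 2"
    using bounded_almost_return [of e "p / 2" k] assms by (auto simp: p_def)
  obtain \<W> :: "'a set set" where \<W>: "finite \<W>" "\<Union>\<W> = UNIV" "\<And>W. W \<in> \<W> \<Longrightarrow> open W"
    "\<And>W x j. W \<in> \<W> \<Longrightarrow> x \<in> W \<Longrightarrow> 0 < j \<Longrightarrow> j < 10 * int Q \<Longrightarrow> U j x \<notin> W"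
    using finite_wandering_cover [of "10 * int Q"] by metis
  define I where "I = {k<..Q} \<times> \<W>"
  define h where "h i = 10 * int (fst i)" for i :: "nat \<times> 'a set"
  define E where "E i = almost_return e (fst i) \<inter> snd i" for i
  have "finite I" using \<W> by (simp add: I_def)
  define \<eta> where "\<eta> = p / (4 * real (card I + 1))"
  have "\<eta> > 0" using assms by (simp add: \<eta>_def p_def)
  have ex: "\<exists>C N. (\<forall>i\<in>I. closed (C i) \<and> C i \<subseteq> E i) \<and> disjoint_blocks I h C \<and>
    N \<in> sets M \<and> measure M N \<le> real (card I) * \<eta> \<and>
    (\<forall>i\<in>I. E i \<subseteq> N \<union> (\<Union>j\<in>I. \<Union>m\<in>{- h j<..<h j}. U m -` C j))"
  proof (rule orbit_vitali [OF \<open>finite I\<close> _ _ _ \<open>\<eta> > 0\<close>])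
    show "open (E i)" if "i \<in> I" for i
      using that \<W> by (auto simp: E_def I_def intro!: open_Int open_almost_return)
    show "h i > 0" if "i \<in> I" for i using that by (auto simp: h_def I_def)
    show "U j x \<notin> E i" if "i \<in> I" "x \<in> E i" "0 < j" "j < h i" for i x j
    proof -
      have "snd i \<in> \<W>" "x \<in> snd i" "h i \<le> 10 * int Q" using that by (auto simp: I_def E_def h_def)
      then have "U j x \<notin> snd i" using that by (intro \<W>(4)) auto
      then show ?thesis by (simp add: E_def)
    qed
  qed
  then obtain C N where C: "\<forall>i\<in>I. closed (C i) \<and> C i \<subseteq> E i" "disjoint_blocks I h C"
    and N: "N \<in> sets M" "measure M N \<le> real (card I) * \<eta>"
    and cover: "\<forall>i\<in>I. E i \<subseteq> N \<union> (\<Union>j\<in>I. \<Union>m\<in>{- h j<..<h j}. U m -` C j)"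
    by (elim exE conjE)
  have C_sets: "C i \<in> sets M" if "i \<in> I" for i using that C(1) closed_in_sets by blast
  define R where "R i = (\<Union>m\<in>{- h i<..<h i}. U m -` C i)" for i
  have R_sets: "R i \<in> sets M" if "i \<in> I" for i
    unfolding R_def using C_sets [OF that] by (intro sets.finite_UN U_vimage_in_sets) auto
  have R_measure: "measure M (R i) \<le> 20 * real (fst i) * measure M (C i)" if "i \<in> I" for i
  proof -
    have "measure M (R i) \<le> (\<Sum>m\<in>{- h i<..<h i}. measure M (U m -` C i))"
      unfolding R_def using C_sets [OF that]
      by (intro finite_measure_subadditive_finite) (auto intro: U_vimage_in_sets)
    also have "\<dots> = real (card {- h i<..<h i}) * measure M (C i)"
      using measure_U_vimage [OF C_sets [OF that]] by simp
    also have "\<dots> \<le> 20 * real (fst i) * measure M (C i)"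
      by (intro mult_right_mono) (auto simp: h_def)
    finally show ?thesis .
  qed
  have "(\<Union>q\<in>{k<..Q}. almost_return e q) \<subseteq> N \<union> (\<Union>i\<in>I. R i)"
  proof clarify
    fix x q assume *: "q \<in> {k<..Q}" "x \<in> almost_return e q" "x \<notin> (\<Union>i\<in>I. R i)"
    obtain W where "W \<in> \<W>" "x \<in> W" using \<W>(2) by blast
    then have "(q, W) \<in> I" "x \<in> E (q, W)" using * by (auto simp: I_def E_def)
    then show "x \<in> N" using cover * unfolding R_def by blast
  qed
  then have "measure M (\<Union>q\<in>{k<..Q}. almost_return e q) \<le> measure M (N \<union> (\<Union>i\<in>I. R i))"
    using N(1) R_sets \<open>finite I\<close> by (intro finite_measure_mono sets.Un sets.finite_UN)
  also have "\<dots> \<le> measure M N + measure M (\<Union>i\<in>I. R i)"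
    using N(1) R_sets \<open>finite I\<close> by (intro measure_Un_le sets.finite_UN)
  also have "measure M (\<Union>i\<in>I. R i) \<le> (\<Sum>i\<in>I. measure M (R i))"
    using R_sets \<open>finite I\<close> by (intro finite_measure_subadditive_finite) auto
  also have "\<dots> \<le> (\<Sum>i\<in>I. 20 * real (fst i) * measure M (C i))"
    by (intro sum_mono R_measure)
  finally have "p / 2 \<le> measure M N + (\<Sum>i\<in>I. 20 * real (fst i) * measure M (C i))"
    using Q by simp
  moreover have "measure M N \<le> p / 4"
  proof -
    have "p * real (card I) \<le> p * (real (card I) + 1)" by (simp add: p_def algebra_simps)
    then have "real (card I) * \<eta> \<le> p / 4" by (simp add: \<eta>_def field_simps)
    then show ?thesis using N(2) by simp
  qed
  ultimately show thesis
    using that [of I Q C] \<open>finite I\<close> C by (auto simp: p_def I_def E_def h_def [abs_def])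
qed

text \<open>
  \<open>G\<close> is the union of the inner halves \<open>2 q \<le> a < 7 q\<close> of the blocks. It has the measure
  \<open>\<Sum>i. 5 q\<^sub>i measure M (C i)\<close>, a quarter of the sum bounded below by \<open>p / 4\<close>.
\<close>

lemma exact_repetition_dense:
  fixes f :: "'a \<Rightarrow>\<^sub>C real"
  assumes "e > 0" "measure M (PRP T) > 0"
  obtains g :: "'a \<Rightarrow>\<^sub>C real" and Q G where "dist g f \<le> e" "G \<in> sets M"
    "measure M (PRP T) / 16 \<le> measure M G"
    "\<And>x. x \<in> G \<Longrightarrow> \<exists>q\<in>{k<..Q}. \<forall>n\<in>{- int (q + k)..int (q + k)}.
       apply_bcontfun g (U n x) = apply_bcontfun g (U (n + int q) x)"
proof -
  let ?f = "apply_bcontfun f"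
  have "uniformly_continuous_on UNIV ?f"
    by (intro compact_uniformly_continuous compact_space) auto
  moreover have "e / 10 > 0" using \<open>e > 0\<close> by simp
  ultimately obtain d where d0: "d > 0"
    "\<forall>x\<in>UNIV. \<forall>y\<in>UNIV. dist y x < d \<longrightarrow> dist (?f y) (?f x) < e / 10"
    unfolding uniformly_continuous_on_def by blast
  then have d: "d > 0" "\<And>x y. dist x y < d \<Longrightarrow> \<bar>?f x - ?f y\<bar> < e / 10"
    by (simp_all add: dist_real_def)
  obtain I :: "(nat \<times> 'a set) set" and C Q where
    I: "finite I" "fst ` I \<subseteq> {k<..Q}" and C: "\<And>i. i \<in> I \<Longrightarrow> closed (C i)"
    "\<And>i. i \<in> I \<Longrightarrow> C i \<subseteq> almost_return d (fst i)"
    and disj: "disjoint_blocks I (\<lambda>i. 10 * int (fst i)) C"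
    and large: "measure M (PRP T) / 4 \<le> (\<Sum>i\<in>I. 20 * real (fst i) * measure M (C i))"
  proof -
    show thesis
      by (rule disjoint_repetitive_blocks [OF d(1) assms(2), of k]) (rule that)
  qed
  have q_pos: "fst i > 0" if "i \<in> I" for i using I(2) that by fastforce
  obtain g :: "'a \<Rightarrow>\<^sub>C real" where g: "dist g f \<le> e"
    "\<And>i a x. i \<in> I \<Longrightarrow> a \<in> {0..<10 * int (fst i)} \<Longrightarrow> x \<in> C i \<Longrightarrow>
        apply_bcontfun g (U a x) = ?f (U (a mod int (fst i)) x)"
  proof (rule periodic_modification [OF I(1) C(1) disj, of f "\<lambda>i. int (fst i)" e])
    show "\<bar>?f (U (a mod int (fst i)) x) - ?f (U a x)\<bar> \<le> e"
      if "i \<in> I" "a \<in> {0..<10 * int (fst i)}" "x \<in> C i" for i a x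
    proof (rule almost_return_oscillation [of x d "fst i" a ?f e])
      show "x \<in> almost_return d (fst i)" using C(2) [OF that(1)] that(3) by blast
    qed (use that(2) q_pos [OF that(1)] d(2) in auto)
  qed (use \<open>e > 0\<close> in auto)
  define J where "J = (SIGMA i:I. {2 * int (fst i)..<7 * int (fst i)})"
  define B where "B = (\<lambda>(i, a). U a ` C i)"
  have "finite J" using I by (simp add: J_def)
  have B_sets: "B p \<in> sets M" if "p \<in> J" for p
    using that C(1) by (auto simp: J_def B_def intro!: closed_in_sets closed_U_image)
  have B_measure: "measure M (B (i, a)) = measure M (C i)" if "i \<in> I" for i a
    unfolding B_def using measure_U_vimage [of "C i" "- a"] closed_in_sets [OF C(1) [OF that]]
    by (simp add: U_image_eq_vimage)
  have "disjoint_family_on B J"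
  proof -
    have "p = p'" if p: "p \<in> J" "p' \<in> J" "z \<in> B p" "z \<in> B p'" for p p' z
    proof -
      obtain i a i' a' x x' where "p = (i, a)" "p' = (i', a')" "x \<in> C i" "x' \<in> C i'"
        "z = U a x" "z = U a' x'"
        using p by (auto simp: B_def J_def)
      then show ?thesis
        using disjoint_blocksD [OF disj, of i i' a a' x x'] p by (auto simp: J_def)
    qed
    then show ?thesis unfolding disjoint_family_on_def by blast
  qed
  then have "measure M (\<Union>p\<in>J. B p) = (\<Sum>p\<in>J. measure M (B p))"
    using B_sets \<open>finite J\<close> by (intro finite_measure_finite_Union) auto
  also have "\<dots> = (\<Sum>i\<in>I. \<Sum>a\<in>{2 * int (fst i)..<7 * int (fst i)}. measure M (B (i, a)))"
    unfolding J_def using I by (subst sum.Sigma) auto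
  also have "\<dots> = (\<Sum>i\<in>I. 5 * real (fst i) * measure M (C i))"
    by (intro sum.cong refl) (simp add: B_measure)
  finally have "4 * measure M (\<Union>p\<in>J. B p) = (\<Sum>i\<in>I. 20 * real (fst i) * measure M (C i))"
    by (simp add: sum_distrib_left algebra_simps)
  show thesis
  proof
    show "dist g f \<le> e" by (fact g)
    show "(\<Union>p\<in>J. B p) \<in> sets M" using B_sets \<open>finite J\<close> by auto
    show "measure M (PRP T) / 16 \<le> measure M (\<Union>p\<in>J. B p)"
      using \<open>4 * _ = _\<close> large by simp
    fix x assume "x \<in> (\<Union>p\<in>J. B p)"
    then obtain i a y where i: "i \<in> I" "a \<in> {2 * int (fst i)..<7 * int (fst i)}" "y \<in> C i" "x = U a y"
      by (auto simp: J_def B_def)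
    have k: "k < fst i" "fst i \<le> Q" using I(2) i(1) by auto
    have "apply_bcontfun g (U n x) = apply_bcontfun g (U (n + int (fst i)) x)"
      if "n \<in> {- int (fst i + k)..int (fst i + k)}" for n
    proof -
      have "apply_bcontfun g (U (n + a) y) = ?f (U ((n + a) mod int (fst i)) y)"
        using i that k by (intro g) auto
      moreover have "apply_bcontfun g (U (n + int (fst i) + a) y)
          = ?f (U ((n + int (fst i) + a) mod int (fst i)) y)"
        using i that k by (intro g) auto
      moreover have "(n + int (fst i) + a) mod int (fst i) = (n + a) mod int (fst i)"
        by (metis add.assoc add.commute mod_add_self2)
      ultimately show ?thesis using i(4) by (simp add: U_add)
    qed
    then show "\<exists>q\<in>{k<..Q}. \<forall>n\<in>{- int (q + k)..int (q + k)}.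
       apply_bcontfun g (U n x) = apply_bcontfun g (U (n + int q) x)"
      using k by (intro bexI [of _ "fst i"]) auto
  qed
qed

section \<open>Approximate repetition and ergodicity\<close>

text \<open>
  Against the definition of a Gordon potential, the window is two-sided, so that one inequality
  covers both \<open>n + q\<close> and \<open>n - q\<close>, and longer by \<open>k\<close>, which allows for shifts. The base
  \<open>k + 1\<close> keeps the tolerance positive for \<open>k = 0\<close>.
\<close>

definition approx_rep :: "('a \<Rightarrow>\<^sub>C real) \<Rightarrow> nat \<Rightarrow> 'a set" where
  "approx_rep f k = {x. \<exists>q>k. \<forall>n\<in>{- int (q + k)..int (q + k)}.
     \<bar>apply_bcontfun f (U n x) - apply_bcontfun f (U (n + int q) x)\<bar> < inverse (real (Suc k)) ^ q}"

lemma open_approx_rep: "open (approx_rep f k)"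
proof -
  have "approx_rep f k = (\<Union>q\<in>{k<..}. \<Inter>n\<in>{- int (q + k)..int (q + k)}.
    {x. \<bar>apply_bcontfun f (U n x) - apply_bcontfun f (U (n + int q) x)\<bar> < inverse (real (Suc k)) ^ q})"
    by (auto simp: approx_rep_def)
  moreover have "continuous_on UNIV (\<lambda>x. apply_bcontfun f (U n x))" for n
    by (rule continuous_on_compose2 [OF continuous_on_apply_bcontfun [of UNIV] continuous_U]) auto
  ultimately show ?thesis
    by (auto intro!: open_UN open_INT open_Collect_less continuous_intros)
qed

text \<open>
  Passing from \<open>k + 1\<close> to \<open>k\<close> shortens the window by one at both ends. With \<open>s = 0\<close> the lemma
  gives monotonicity in \<open>k\<close>, with \<open>s = 1\<close> and \<open>s = - 1\<close> invariance of the intersection over \<open>k\<close>.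
\<close>

lemma approx_rep_shift:
  assumes "x \<in> approx_rep f (Suc k)" "\<bar>s\<bar> \<le> 1"
  shows "U s x \<in> approx_rep f k"
proof -
  obtain q where q: "q > Suc k" and *: "\<And>n. n \<in> {- int (q + Suc k)..int (q + Suc k)} \<Longrightarrow>
     \<bar>apply_bcontfun f (U n x) - apply_bcontfun f (U (n + int q) x)\<bar> < inverse (real (Suc (Suc k))) ^ q"
    using assms(1) unfolding approx_rep_def by blast
  have "inverse (real (Suc (Suc k))) ^ q \<le> inverse (real (Suc k)) ^ q"
    by (intro power_mono le_imp_inverse_le) auto
  moreover have "\<bar>apply_bcontfun f (U n (U s x)) - apply_bcontfun f (U (n + int q) (U s x))\<bar>
      < inverse (real (Suc (Suc k))) ^ q" if "n \<in> {- int (q + k)..int (q + k)}" for n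
  proof -
    have "n + s \<in> {- int (q + Suc k)..int (q + Suc k)}" using that assms(2) by auto
    from * [OF this] show ?thesis by (simp add: ac_simps flip: U_add)
  qed
  ultimately have "\<forall>n\<in>{- int (q + k)..int (q + k)}.
      \<bar>apply_bcontfun f (U n (U s x)) - apply_bcontfun f (U (n + int q) (U s x))\<bar>
        < inverse (real (Suc k)) ^ q"
    using order_less_le_trans by blast
  then show ?thesis using Suc_lessD [OF q] unfolding approx_rep_def mem_Collect_eq by blast
qed

text \<open>The intersection has measure at least \<open>c > 0\<close> by continuity from above and is invariant, so ergodicity leaves only the value \<open>1\<close>.\<close>

lemma full_measure_of_approx_rep:
  assumes "c > 0" "\<And>k. c \<le> measure M (approx_rep f k)"
  shows "measure M (\<Inter>k. approx_rep f k) = 1"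
proof -
  let ?R = "\<Inter>k. approx_rep f k"
  have sets: "range (approx_rep f) \<subseteq> sets M" using open_approx_rep open_in_sets by blast
  have "decseq (approx_rep f)"
    unfolding decseq_Suc_iff using approx_rep_shift [where s = 0] by auto
  with sets have "(\<lambda>k. measure M (approx_rep f k)) \<longlonglongrightarrow> measure M ?R"
    by (rule finite_Lim_measure_decseq)
  then have "c \<le> measure M ?R" using assms(2) by (intro LIMSEQ_le_const) auto
  moreover have "T -` ?R = ?R"
  proof (intro equalityI subsetI)
    fix x assume x: "x \<in> ?R"
    have "T x \<in> approx_rep f k" for k
    proof -
      have "x \<in> approx_rep f (Suc k)" using x by blast
      from approx_rep_shift [OF this, of 1] show ?thesis by (simp add: U_1)
    qed
    then show "x \<in> T -` ?R" by blast
  next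
    fix x assume x: "x \<in> T -` ?R"
    have "x \<in> approx_rep f k" for k
    proof -
      have "T x \<in> approx_rep f (Suc k)" using x by blast
      from approx_rep_shift [OF this, of "- 1"] show ?thesis
        using U_minus_cancel(2) [of 1 x] by (simp add: U_1)
    qed
    then show "x \<in> ?R" by blast
  qed
  moreover have "?R \<in> sets M" using sets by auto
  ultimately show ?thesis
    using ergodic assms(1) unfolding ergodic_borel_prob_def by force
qed

lemma approx_rep_imp_gordon:
  assumes "x \<in> (\<Inter>k. approx_rep f k)"
  shows "gordon_potential (\<lambda>n. apply_bcontfun f (U n x))"
proof -
  let ?V = "\<lambda>n. apply_bcontfun f (U n x)"
  have "\<forall>k. \<exists>q>k. \<forall>n\<in>{- int (q + k)..int (q + k)}.
     \<bar>?V n - ?V (n + int q)\<bar> < inverse (real (Suc k)) ^ q"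
    using assms unfolding approx_rep_def by blast
  then obtain p where p: "\<And>k. p k > k" "\<And>k n. n \<in> {- int (p k + k)..int (p k + k)} \<Longrightarrow>
     \<bar>?V n - ?V (n + int (p k))\<bar> < inverse (real (Suc k)) ^ p k" by metis
  \<comment> \<open>The tolerance of \<open>approx_rep f k\<close> has base \<open>k + 1\<close>, whence the shift of the index.\<close>
  define q where "q k = p (k - 1)" for k
  have q_ge: "q k \<ge> k" for k using p(1) [of "k - 1"] by (simp add: q_def)
  have q_close: "\<bar>?V n - ?V (n + int (q k))\<bar> \<le> real k powi (- int (q k))"
    if "k \<ge> 1" "n \<in> {- int (q k)..int (q k)}" for k n
    using p(2) [of n "k - 1"] that by (simp add: q_def power_int_minus power_inverse)
  have "bounded (range ?V)"
    by (rule bounded_subset [OF bounded_apply_bcontfun]) auto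
  moreover have "filterlim q at_top sequentially"
    by (rule filterlim_at_top_mono [OF filterlim_ident]) (simp add: q_ge)
  moreover have "(MAX n\<in>{1..int (q k)}. \<bar>?V n - ?V (n + int (q k))\<bar>) \<le> real k powi (- int (q k))"
    "(MAX n\<in>{1..int (q k)}. \<bar>?V n - ?V (n - int (q k))\<bar>) \<le> real k powi (- int (q k))"
    if "k \<ge> 1" for k
  proof -
    have "q k \<ge> 1" using q_ge [of k] that by simp
    then have ne: "{1..int (q k)} \<noteq> {}" by simp
    show "(MAX n\<in>{1..int (q k)}. \<bar>?V n - ?V (n + int (q k))\<bar>) \<le> real k powi (- int (q k))"
      using ne q_close [OF that] by (subst Max_le_iff) auto
    show "(MAX n\<in>{1..int (q k)}. \<bar>?V n - ?V (n - int (q k))\<bar>) \<le> real k powi (- int (q k))"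
    proof (subst Max_le_iff; (intro ballI)?)
      fix v assume "v \<in> (\<lambda>n. \<bar>?V n - ?V (n - int (q k))\<bar>) ` {1..int (q k)}"
      then obtain n where "n \<in> {1..int (q k)}" "v = \<bar>?V n - ?V (n - int (q k))\<bar>" by blast
      then show "v \<le> real k powi (- int (q k))"
        using q_close [OF that, of "n - int (q k)"] by (simp add: abs_minus_commute)
    qed (use ne in auto)
  qed
  moreover have "q k > 0" if "k \<ge> 1" for k using q_ge [of k] that by simp
  ultimately show ?thesis unfolding gordon_potential_def by blast
qed

section \<open>Genericity\<close>

lemma dense_interior_large_approx_rep:
  assumes "measure M (PRP T) > 0"
  shows "closure (interior {f. measure M (PRP T) / 16 \<le> measure M (approx_rep f k)}) = UNIV"
proof -
  let ?L = "{f. measure M (PRP T) / 16 \<le> measure M (approx_rep f k)}"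
  have "\<exists>g\<in>interior ?L. dist g f < e" if e: "e > 0" for f e
  proof -
    obtain g Q G where g: "dist g f \<le> e / 2" "G \<in> sets M" "measure M (PRP T) / 16 \<le> measure M G"
      "\<And>x. x \<in> G \<Longrightarrow> \<exists>q\<in>{k<..Q}. \<forall>n\<in>{- int (q + k)..int (q + k)}.
         apply_bcontfun g (U n x) = apply_bcontfun g (U (n + int q) x)"
    proof -
      show thesis
        by (rule exact_repetition_dense [OF half_gt_zero [OF e] assms, of f k]) (rule that)
    qed
    \<comment> \<open>\<open>Q\<close> bounds all periods used on \<open>G\<close>, so \<open>\<tau>\<close> is the strictest tolerance to be met.\<close>
    define \<tau> where "\<tau> = inverse (real (Suc k)) ^ Q"
    have "\<tau> > 0" by (simp add: \<tau>_def)
    have "ball g (\<tau> / 2) \<subseteq> ?L"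
    proof
      fix f' assume "f' \<in> ball g (\<tau> / 2)"
      then have near: "\<bar>apply_bcontfun f' z - apply_bcontfun g z\<bar> < \<tau> / 2" for z
        using dist_bounded [of f' z g] by (simp add: dist_real_def dist_commute)
      have "G \<subseteq> approx_rep f' k"
      proof
        fix x assume "x \<in> G"
        then obtain q where q: "q \<in> {k<..Q}" "\<And>n. n \<in> {- int (q + k)..int (q + k)} \<Longrightarrow>
          apply_bcontfun g (U n x) = apply_bcontfun g (U (n + int q) x)"
          using g(4) by blast
        have "\<tau> \<le> inverse (real (Suc k)) ^ q"
          unfolding \<tau>_def using q(1) by (intro power_decreasing) (auto simp: field_simps)
        then have "\<bar>apply_bcontfun f' (U n x) - apply_bcontfun f' (U (n + int q) x)\<bar>
            < inverse (real (Suc k)) ^ q" if "n \<in> {- int (q + k)..int (q + k)}" for n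
          using near [of "U n x"] near [of "U (n + int q) x"] q(2) [OF that] by linarith
        then show "x \<in> approx_rep f' k" using q(1) unfolding approx_rep_def by auto
      qed
      then have "measure M G \<le> measure M (approx_rep f' k)"
        by (intro finite_measure_mono open_in_sets open_approx_rep)
      then show "f' \<in> ?L" using g(3) by simp
    qed
    then have "g \<in> interior ?L" using \<open>\<tau> > 0\<close> by (meson centre_in_ball half_gt_zero interiorI open_ball)
    then show ?thesis using g(1) e by (intro bexI [of _ g]) auto
  qed
  then show ?thesis by (auto simp: closure_approachable)
qed

lemma generic_gordon:
  assumes "measure M (PRP T) > 0"
  shows "\<exists>\<F> :: ('a \<Rightarrow>\<^sub>C real) set. residual \<F> \<and>
           (\<forall>f\<in>\<F>. \<exists>\<Omega>\<^sub>f\<in>sets M. measure M \<Omega>\<^sub>f = 1 \<and>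
              (\<forall>\<omega>\<in>\<Omega>\<^sub>f. gordon_potential (\<lambda>n. apply_bcontfun f (U n \<omega>))))"
proof -
  define L where "L k = interior {f. measure M (PRP T) / 16 \<le> measure M (approx_rep f k)}" for k
  have "open (L k)" "closure (L k) = UNIV" for k
    unfolding L_def by (rule open_interior, rule dense_interior_large_approx_rep [OF assms])
  then have "residual (\<Inter>k. L k)"
    unfolding residual_def by (intro exI [of _ "range L"]) auto
  moreover have "\<exists>\<Omega>\<^sub>f\<in>sets M. measure M \<Omega>\<^sub>f = 1 \<and>
      (\<forall>\<omega>\<in>\<Omega>\<^sub>f. gordon_potential (\<lambda>n. apply_bcontfun f (U n \<omega>)))" if "f \<in> (\<Inter>k. L k)" for f
  proof (intro bexI [of _ "\<Inter>k. approx_rep f k"] conjI ballI approx_rep_imp_gordon)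
    have "measure M (PRP T) / 16 \<le> measure M (approx_rep f k)" for k
      using that interior_subset unfolding L_def by blast
    then show "measure M (\<Inter>k. approx_rep f k) = 1"
      using assms by (intro full_measure_of_approx_rep [of "measure M (PRP T) / 16"]) simp_all
    show "(\<Inter>k. approx_rep f k) \<in> sets M"
      using open_approx_rep open_in_sets by (intro sets.countable_INT) auto
  qed
  ultimately show ?thesis by blast
qed

end

theorem theorem2:
  fixes T :: "'a::metric_space \<Rightarrow> 'a" and \<mu> :: "'a measure"
  assumes "infinite (UNIV :: 'a set)"
    and "compact (UNIV :: 'a set)"
    and "minimal_homeomorphism T"
    and "ergodic_borel_prob T \<mu>"
    and "MRP T \<mu>"
  shows "\<exists>\<F> :: ('a \<Rightarrow>\<^sub>C real) set. residual \<F> \<and>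
           (\<forall>f\<in>\<F>. \<exists>\<Omega>\<^sub>f\<in>sets \<mu>. measure \<mu> \<Omega>\<^sub>f = 1 \<and>
              (\<forall>\<omega>\<in>\<Omega>\<^sub>f. gordon_potential (\<lambda>n. apply_bcontfun f (int_iterate T n \<omega>))))"
proof -
  interpret prob_space \<mu> using assms(4) by (simp add: ergodic_borel_prob_def)
  interpret minimal_pmp \<mu> T by unfold_locales (use assms in auto)
  show ?thesis by (rule generic_gordon [OF assms(5) [unfolded MRP_def]])
qed

end
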